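(* Let $\xi(G)$ be the orthogonal rank of a graph $G$ with inertia $(n^+,n^0,n^-)$. Then \[ 1 + \max\left(\frac{n^+}{n^-}, \frac{n^-}{n^+} \right) \le \xi(G). \]
   Context: For a graph $G=(V,E)$ with $|V|=n$ vertices and adjacency matrix $A$, the inertia of $G$ is the ordered triple $(n^+,n^0,n^-)$, where $n^+$, $n^0$, $n^-$ are the numbers of positive, zero and negative eigenvalues of $A$, counted with multiplicity. The orthogonal rank $\xi(G)$ is the smallest positive integer $\xi$ such that there exist non-zero column vectors $x_v\in\mathbb{C}^{\xi}$, $v\in V$, with $x_v^\dagger x_w=0$ for all edges $vw\in E$ (where $\dagger$ denotes conjugate transpose). *)

theory Defs
  imports "Jordan_Normal_Form.Char_Poly" "Graph_Theory.Digraph"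
begin

text \<open>A finite simple graph is a value \<open>G\<close> of the record type \<open>('a, 'b) pre_digraph\<close> satisfying the
  locale predicate \<open>graph\<close> of \<open>Graph_Theory.Digraph\<close>: finite, loop-free, without parallel arcs, and
  with each edge represented by its two opposite arcs.\<close>

text \<open>Matrices are indexed by natural numbers, so the adjacency matrix is taken with respect to a
  listing of the vertices; different listings give permutation-similar matrices.\<close>

definition adjacency_matrix :: "('a, 'b) pre_digraph \<Rightarrow> 'a list \<Rightarrow> real mat" where
  "adjacency_matrix G vs =
     mat (length vs) (length vs) (\<lambda>(i, j). if vs ! i \<rightarrow>\<^bsub>G\<^esub> vs ! j then 1 else 0)"

text \<open>Only real eigenvalues are counted, which for a symmetric real matrix is all of them;
  the multiplicity is that of the root of the characteristic polynomial. An adjacency matrix has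
  trace zero, so the numbers of positive and of negative eigenvalues vanish only together, namely
  when there are no edges; their ratios, both \<open>0 / 0\<close>, are then \<open>0\<close>.\<close>

definition count_eigenvalues :: "real mat \<Rightarrow> real set \<Rightarrow> nat" where
  "count_eigenvalues A S = (\<Sum>k | k \<in> S \<and> eigenvalue A k. Polynomial.order k (char_poly A))"

definition inertia :: "real mat \<Rightarrow> nat \<times> nat \<times> nat" where
  "inertia A =
     (count_eigenvalues A {0<..}, count_eigenvalues A {0}, count_eigenvalues A {..<0})"

definition orthogonal_representation ::
  "('a, 'b) pre_digraph \<Rightarrow> nat \<Rightarrow> ('a \<Rightarrow> complex vec) \<Rightarrow> bool" where
  "orthogonal_representation G d x \<longleftrightarrow>
     (\<forall>v \<in> verts G. x v \<in> carrier_vec d \<and> x v \<noteq> 0\<^sub>v d) \<and>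
     (\<forall>v w. v \<rightarrow>\<^bsub>G\<^esub> w \<longrightarrow> conjugate (x v) \<bullet> x w = 0)"

definition orthogonal_rank :: "('a, 'b) pre_digraph \<Rightarrow> nat" where
  "orthogonal_rank G = (LEAST d. 0 < d \<and> (\<exists>x. orthogonal_representation G d x))"

lemma ex_orthogonal_representation:
  assumes "graph G"
  shows "\<exists>d>0. \<exists>x. orthogonal_representation G d x"
proof -
  interpret graph G by (rule assms)
  obtain f :: "'a \<Rightarrow> nat" and n where f: "f ` verts G = {i. i < n}" "inj_on f (verts G)"
    using finite_imp_inj_to_nat_seg[OF finite_verts] by blast
  let ?x = "\<lambda>v. unit_vec (Suc n) (f v) :: complex vec"
  have lt: "f v < Suc n" if "v \<in> verts G" for v
  proof -
    have "f v \<in> f ` verts G"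
      using that by (rule imageI)
    then show ?thesis
      by (simp add: f(1))
  qed
  have "conjugate (?x v) \<bullet> ?x w = 0" if "v \<rightarrow>\<^bsub>G\<^esub> w" for v w
  proof -
    have vw: "v \<in> verts G" "w \<in> verts G" "v \<noteq> w"
      using that no_loops by (auto elim!: reachableE)
    then have "f v \<noteq> f w"
      using f(2) by (auto dest: inj_onD)
    then show ?thesis
      using lt[OF vw(1)] lt[OF vw(2)]
      by (simp add: scalar_prod_right_unit[where n = "Suc n"] conjugate_vec_def)
  qed
  moreover have "?x v \<noteq> 0\<^sub>v (Suc n)" if "v \<in> verts G" for v
    using lt[OF that] by simp
  ultimately have "orthogonal_representation G (Suc n) ?x"
    unfolding orthogonal_representation_def by auto
  then show ?thesis
    by blast
qed

lemma orthogonal_rank_attained: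
  assumes "graph G"
  shows "0 < orthogonal_rank G" "\<exists>x. orthogonal_representation G (orthogonal_rank G) x"
  using LeastI_ex[OF ex_orthogonal_representation[OF assms]]
  unfolding orthogonal_rank_def by auto

end

theory Submission
  imports Defs "Jordan_Normal_Form.Spectral_Radius" "Jordan_Normal_Form.Schur_Decomposition"
begin

text \<open>
  Write \<open>A\<close> for the adjacency matrix and let \<open>x\<close> be an orthogonal representation in dimension \<open>m\<close>.
  The claim is the pair of bounds \<open>n_pos \<le> (m - 1) * n_neg\<close> and \<open>n_neg \<le> (m - 1) * n_pos\<close>, and the
  first one suffices: its argument only uses that the entries of \<open>A\<close> vanish wherever
  \<open>x v\<close> and \<open>x w\<close> are not orthogonal, so it applies to \<open>- A\<close> as well, and this exchanges \<open>n_pos\<close> and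
  \<open>n_neg\<close>.

  For every scalar function \<open>u\<close> on the vertices, the family of vectors \<open>u v \<cdot> x v\<close> is a null vector of
  the Hermitian form \<open>A \<otimes> 1\<close> on \<open>\<complex>\<^sup>n \<otimes> \<complex>\<^sup>m\<close>, because there the entry of \<open>A\<close> at
  \<open>(v, w)\<close> is multiplied by the inner product of \<open>x v\<close> and \<open>x w\<close>, and one of the two is zero.
  Choose a linear functional \<open>f\<close> on \<open>\<complex>\<^sup>m\<close> that vanishes on no \<open>x v\<close>. Then \<open>u\<close> can be chosen so that applying \<open>f\<close> to the family gives any prescribed
  vector of \<open>\<complex>\<^sup>n\<close>; prescribe a combination \<open>a\<close> of eigenvectors for positive eigenvalues. Now require
  all components of the family along eigenvectors for negative eigenvalues to vanish. Such a component
  is a vector of \<open>\<complex>\<^sup>m\<close> that \<open>f\<close> already maps to \<open>0\<close>, since \<open>a\<close> is orthogonal to these eigenvectors;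
  thus only \<open>m - 1\<close> of its coordinates must be killed, which makes \<open>(m - 1) * n_neg\<close> linear equations
  for the \<open>n_pos\<close> coefficients of \<open>a\<close>. If \<open>n_pos > (m - 1) * n_neg\<close>, some \<open>a \<noteq> 0\<close> solves them
  (\<open>underdetermined_system\<close>). On the resulting null vector the form is a sum of nonnegative terms, so
  its components along the eigenvectors for positive eigenvalues vanish too; applying \<open>f\<close> to them
  gives \<open>a = 0\<close>, a contradiction. This is \<open>card_positive_le_card_negative\<close>.

  To apply it to \<open>A\<close>, an orthonormal eigenbasis is needed whose eigenvalues are the roots of the
  characteristic polynomial with their multiplicities. It comes from the spectral theorem for
  Hermitian matrices (\<open>hermitian_unitarily_diagonalizable\<close>), and \<open>count_eigenvalues_eq_card\<close> turns
  the inertia into the numbers of positive and negative diagonal entries.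
\<close>

section \<open>Isotropic families and the signs of a Hermitian form\<close>

text \<open>Gaussian elimination, one equation at a time: an equation with a nonzero coefficient at \<open>i\<close> is
  used to eliminate the unknown \<open>i\<close>, which costs one equation and one unknown.\<close>

lemma underdetermined_system:
  fixes M :: "'k \<Rightarrow> 'j \<Rightarrow> 'f::field"
  assumes "finite K" "finite J" "card K < card J"
  shows "\<exists>b. (\<exists>j\<in>J. b j \<noteq> 0) \<and> (\<forall>k\<in>K. (\<Sum>j\<in>J. M k j * b j) = 0)"
  using assms
proof (induction K arbitrary: J M rule: finite_induct)
  case empty
  then have "\<exists>j. j \<in> J"
    by (metis card.empty equals0I less_irrefl)
  then show ?case
    by (intro exI[of _ "\<lambda>_. 1"]) auto
next
  case (insert l K)
  show ?case
  proof (cases "\<forall>j\<in>J. M l j = 0")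
    case True
    have "card K < card J"
      using insert by simp
    then obtain b where "\<exists>j\<in>J. b j \<noteq> 0" "\<forall>k\<in>K. (\<Sum>j\<in>J. M k j * b j) = 0"
      using insert.IH[OF insert.prems(1)] by blast
    with True show ?thesis
      by auto
  next
    case False
    then obtain i where i: "i \<in> J" "M l i \<noteq> 0"
      by auto
    \<comment> \<open>\<open>N\<close> is the system after the elimination of the unknown \<open>i\<close>; its row \<open>l\<close> is zero.\<close>
    define N where "N k j = M k j - M k i * (M l j / M l i)" for k j
    have "card K < card (J - {i})"
      using insert i by simp
    then obtain b where b: "\<exists>j\<in>J - {i}. b j \<noteq> 0"
        "\<forall>k\<in>K. (\<Sum>j\<in>J - {i}. N k j * b j) = 0"
      using insert.IH[of "J - {i}" N] insert.prems(1) by blast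
    define c where "c = b(i := - (\<Sum>j\<in>J - {i}. M l j * b j) / M l i)"
    have split: "(\<Sum>j\<in>J. M k j * c j) = (\<Sum>j\<in>J - {i}. N k j * b j)" for k
    proof -
      have "(\<Sum>j\<in>J. M k j * c j) = M k i * c i + (\<Sum>j\<in>J - {i}. M k j * c j)"
        by (rule sum.remove) (use i insert.prems in auto)
      also have "(\<Sum>j\<in>J - {i}. M k j * c j) = (\<Sum>j\<in>J - {i}. M k j * b j)"
        by (rule sum.cong) (auto simp: c_def)
      also have "M k i * c i = - (\<Sum>j\<in>J - {i}. M k i * (M l j / M l i) * b j)"
        by (simp add: c_def sum_distrib_left sum_divide_distrib sum_negf[symmetric] mult.assoc)
      finally show ?thesis
        by (simp add: N_def sum_subtractf algebra_simps)
    qed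
    have "N l j = 0" for j
      using i by (simp add: N_def)
    with b(2) have "\<forall>k\<in>insert l K. (\<Sum>j\<in>J. M k j * c j) = 0"
      unfolding split by simp
    moreover have "\<exists>j\<in>J. c j \<noteq> 0"
      using b(1) by (auto simp: c_def)
    ultimately show ?thesis
      by blast
  qed
qed

text \<open>Finitely many nonzero vectors have a common functional that vanishes on none of them. On the
  moment curve \<open>(1, t, t\<^sup>2, \<dots>)\<close> each vector excludes only the finitely many roots of a nonzero
  polynomial. Its functionals have coefficient \<open>1\<close> at coordinate \<open>0\<close>, which is therefore determined
  by the other coordinates and the value of the functional.\<close>

lemma ex_generic_moment_functional:
  fixes x :: "'v \<Rightarrow> nat \<Rightarrow> complex"
  assumes "finite V" and "\<And>v. v \<in> V \<Longrightarrow> \<exists>k<m. x v k \<noteq> 0"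
  shows "\<exists>t. \<forall>v\<in>V. (\<Sum>k<m. t ^ k * x v k) \<noteq> 0"
proof -
  define q where "q v = (\<Sum>k<m. monom (x v k) k)" for v
  have "q v \<noteq> 0" if v: "v \<in> V" for v
  proof -
    obtain k where k: "k < m" "x v k \<noteq> 0"
      using assms(2)[OF v] by blast
    have "coeff (q v) k = (\<Sum>j<m. if j = k then x v j else 0)"
      by (auto simp: q_def coeff_sum coeff_monom intro!: sum.cong)
    with k show ?thesis
      by auto
  qed
  then have "finite (\<Union>v\<in>V. {t. poly (q v) t = 0})"
    using assms(1) by (auto intro: poly_roots_finite)
  then obtain t where "t \<notin> (\<Union>v\<in>V. {t. poly (q v) t = 0})"
    using ex_new_if_finite infinite_UNIV_char_0 by blast
  then have "\<forall>v\<in>V. poly (q v) t \<noteq> 0"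
    by blast
  moreover have "poly (q v) t = (\<Sum>k<m. t ^ k * x v k)" for v
    by (simp add: q_def poly_sum poly_monom mult.commute)
  ultimately show ?thesis
    by auto
qed

lemma sum_swap_pairs:
  "(\<Sum>i\<in>A. \<Sum>j\<in>B. \<Sum>k\<in>C. \<Sum>l\<in>D. f i j k l) = (\<Sum>k\<in>C. \<Sum>l\<in>D. \<Sum>i\<in>A. \<Sum>j\<in>B. f i j k l)"
proof -
  have "(\<Sum>i\<in>A. \<Sum>j\<in>B. \<Sum>k\<in>C. \<Sum>l\<in>D. f i j k l) = (\<Sum>i\<in>A. \<Sum>k\<in>C. \<Sum>l\<in>D. \<Sum>j\<in>B. f i j k l)"
    by (rule sum.cong[OF refl], subst sum.swap, rule sum.cong[OF refl], rule sum.swap)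
  also have "\<dots> = (\<Sum>k\<in>C. \<Sum>l\<in>D. \<Sum>i\<in>A. \<Sum>j\<in>B. f i j k l)"
    by (subst sum.swap, rule sum.cong[OF refl], rule sum.swap)
  finally show ?thesis .
qed

text \<open>The matrix is given by its orthonormal eigenvectors \<open>\<lambda>v. p v i\<close> and eigenvalues \<open>d i\<close>, so that
  the argument sees nothing but the decomposition and applies to the negated matrix. In the proof,
  \<open>l v\<close> is the value of the generic functional at \<open>x v\<close>, the numbers \<open>b j\<close> are the coefficients of
  the positive combination, \<open>u\<close> is the function that makes the family \<open>u v \<cdot> x v\<close> map to this
  combination, and \<open>c i k\<close> is the \<open>k\<close>-th coordinate of the component of the family along the
  \<open>i\<close>-th eigenvector.\<close>

lemma card_positive_le_card_negative:
  fixes d :: "'i \<Rightarrow> real" and p :: "'v \<Rightarrow> 'i \<Rightarrow> complex" and x :: "'v \<Rightarrow> nat \<Rightarrow> complex"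
  assumes fin: "finite V" "finite I" and m: "0 < m"
    and orth: "\<And>i j. i \<in> I \<Longrightarrow> j \<in> I \<Longrightarrow> (\<Sum>v\<in>V. cnj (p v i) * p v j) = (if i = j then 1 else 0)"
    and nonzero: "\<And>v. v \<in> V \<Longrightarrow> \<exists>k<m. x v k \<noteq> 0"
    and isotropic: "\<And>v w. v \<in> V \<Longrightarrow> w \<in> V \<Longrightarrow>
      (\<Sum>i\<in>I. complex_of_real (d i) * p v i * cnj (p w i)) * (\<Sum>k<m. cnj (x v k) * x w k) = 0"
  shows "card {i\<in>I. 0 < d i} \<le> (m - 1) * card {i\<in>I. d i < 0}"
proof (rule ccontr)
  define J where "J = {i\<in>I. 0 < d i}"
  \<comment> \<open>Coordinate \<open>0\<close> is left out of the equations: it is recovered from the functional, which is why the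
    factor is \<open>m - 1\<close> and not \<open>m\<close>.\<close>
  define K where "K = {i\<in>I. d i < 0} \<times> {1..<m}"
  have finJK: "finite J" "finite K"
    using fin by (auto simp: J_def K_def)
  assume "\<not> ?thesis"
  then have card: "card K < card J"
    by (simp add: J_def K_def card_cartesian_product mult.commute)
  obtain t where t: "\<And>v. v \<in> V \<Longrightarrow> (\<Sum>k<m. t ^ k * x v k) \<noteq> 0"
    using ex_generic_moment_functional[of V m x] fin(1) nonzero by blast
  define l where "l v = (\<Sum>k<m. t ^ k * x v k)" for v
  define M where "M = (\<lambda>(i, k) j. \<Sum>v\<in>V. cnj (p v i) * x v k * p v j / l v)"
  obtain b where b: "\<exists>j\<in>J. b j \<noteq> 0" "\<And>r. r \<in> K \<Longrightarrow> (\<Sum>j\<in>J. M r j * b j) = 0"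
    using underdetermined_system[OF finJK(2,1) card, of M] by blast
  define u where "u v = (\<Sum>j\<in>J. b j * p v j) / l v" for v
  define c where "c i k = (\<Sum>v\<in>V. cnj (p v i) * (x v k * u v))" for i k
  have c_M: "c i k = (\<Sum>j\<in>J. M (i, k) j * b j)" for i k
  proof -
    have "c i k = (\<Sum>v\<in>V. \<Sum>j\<in>J. cnj (p v i) * x v k * p v j / l v * b j)"
      by (simp add: c_def u_def sum_divide_distrib sum_distrib_left algebra_simps)
    also have "\<dots> = (\<Sum>j\<in>J. \<Sum>v\<in>V. cnj (p v i) * x v k * p v j / l v * b j)"
      by (rule sum.swap)
    finally show ?thesis
      by (simp add: M_def sum_distrib_right)
  qed
  \<comment> \<open>The functional maps the family to the positive combination, so its components are known.\<close>
  have moment: "(\<Sum>k<m. t ^ k * c i k) = (if i \<in> J then b i else 0)" if i: "i \<in> I" for i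
  proof -
    have "(\<Sum>k<m. t ^ k * c i k) = (\<Sum>k<m. \<Sum>v\<in>V. cnj (p v i) * u v * (t ^ k * x v k))"
      by (simp add: c_def sum_distrib_left algebra_simps)
    also have "\<dots> = (\<Sum>v\<in>V. \<Sum>k<m. cnj (p v i) * u v * (t ^ k * x v k))"
      by (rule sum.swap)
    also have "\<dots> = (\<Sum>v\<in>V. cnj (p v i) * (u v * l v))"
      by (simp add: l_def sum_distrib_left mult.assoc)
    also have "\<dots> = (\<Sum>v\<in>V. \<Sum>j\<in>J. b j * (cnj (p v i) * p v j))"
    proof (rule sum.cong)
      fix v assume "v \<in> V"
      then have "l v \<noteq> 0"
        using t by (simp add: l_def)
      then have ul: "u v * l v = (\<Sum>j\<in>J. b j * p v j)"
        by (simp add: u_def)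
      show "cnj (p v i) * (u v * l v) = (\<Sum>j\<in>J. b j * (cnj (p v i) * p v j))"
        by (simp only: ul sum_distrib_left mult.left_commute)
    qed simp
    also have "\<dots> = (\<Sum>j\<in>J. \<Sum>v\<in>V. b j * (cnj (p v i) * p v j))"
      by (rule sum.swap)
    also have "\<dots> = (\<Sum>j\<in>J. b j * (if i = j then 1 else 0))"
      by (rule sum.cong) (use i orth in \<open>auto simp: sum_distrib_left[symmetric] J_def\<close>)
    also have "\<dots> = (\<Sum>j\<in>J. if i = j then b j else 0)"
      by (rule sum.cong) auto
    also have "\<dots> = (if i \<in> J then b i else 0)"
      using finJK(1) by (rule sum.delta')
    finally show ?thesis .
  qed
  have negative: "c i k = 0" if i: "i \<in> I" "d i < 0" and k: "k < m" for i k
  proof -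
    have pos: "c i k = 0" if "0 < k" "k < m" for k
      using b(2)[of "(i, k)"] i that by (auto simp: c_M K_def)
    have "(\<Sum>k<m. t ^ k * c i k) = (\<Sum>k\<in>{0}. t ^ k * c i k)"
      by (rule sum.mono_neutral_right) (use m pos in auto)
    moreover have "i \<notin> J"
      using i by (simp add: J_def)
    ultimately have "c i 0 = 0"
      using moment[OF i(1)] by simp
    with pos k show ?thesis
      by (cases "k = 0") auto
  qed
  \<comment> \<open>The value of the form on the family, computed in the eigenbasis and at the vertices.\<close>
  have "c i k * cnj (c i k) =
      (\<Sum>w\<in>V. \<Sum>v\<in>V. cnj (p w i) * (x w k * u w) * (p v i * (cnj (x v k) * cnj (u v))))" for i k
    by (simp add: c_def sum_product)
  then have "complex_of_real (d i) * (c i k * cnj (c i k)) =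
      (\<Sum>w\<in>V. \<Sum>v\<in>V. (complex_of_real (d i) * p v i * cnj (p w i)) *
          (cnj (x v k) * x w k) * (u w * cnj (u v)))" for i k
    by (simp add: sum_distrib_left mult.commute mult.left_commute)
  then have "(\<Sum>i\<in>I. \<Sum>k<m. complex_of_real (d i) * (c i k * cnj (c i k)))
      = (\<Sum>i\<in>I. \<Sum>k<m. \<Sum>w\<in>V. \<Sum>v\<in>V. (complex_of_real (d i) * p v i * cnj (p w i)) *
          (cnj (x v k) * x w k) * (u w * cnj (u v)))"
    by simp
  also have "\<dots> = (\<Sum>w\<in>V. \<Sum>v\<in>V. \<Sum>i\<in>I. \<Sum>k<m. (complex_of_real (d i) * p v i * cnj (p w i)) *
          (cnj (x v k) * x w k) * (u w * cnj (u v)))"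
    by (rule sum_swap_pairs)
  also have "\<dots> = (\<Sum>w\<in>V. \<Sum>v\<in>V. ((\<Sum>i\<in>I. complex_of_real (d i) * p v i * cnj (p w i)) *
          (\<Sum>k<m. cnj (x v k) * x w k)) * (u w * cnj (u v)))"
    by (simp only: sum_product) (simp only: sum_distrib_right)
  also have "\<dots> = 0"
    using isotropic by simp
  finally have "(\<Sum>i\<in>I. \<Sum>k<m. complex_of_real (d i) * (c i k * cnj (c i k))) = 0" .
  then have "complex_of_real (\<Sum>i\<in>I. \<Sum>k<m. d i * (cmod (c i k))\<^sup>2) = 0"
    by (simp add: complex_norm_square del: of_real_power)
  then have zero: "(\<Sum>i\<in>I. \<Sum>k<m. d i * (cmod (c i k))\<^sup>2) = 0"
    using of_real_eq_0_iff by blast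
  have nonneg: "0 \<le> d i * (cmod (c i k))\<^sup>2" if "i \<in> I" "k < m" for i k
    using negative[of i k] that by (cases "d i < 0") auto
  have "c i k = 0" if i: "i \<in> J" "k < m" for i k
  proof -
    have iI: "i \<in> I" "0 < d i"
      using i by (auto simp: J_def)
    have "(\<Sum>k<m. d i * (cmod (c i k))\<^sup>2) = 0"
      using zero iI nonneg fin by (subst (asm) sum_nonneg_eq_0_iff) (auto intro!: sum_nonneg)
    then have "d i * (cmod (c i k))\<^sup>2 = 0"
      using iI nonneg i(2) by (subst (asm) sum_nonneg_eq_0_iff) auto
    with iI show ?thesis
      by simp
  qed
  then have "b i = 0" if "i \<in> J" for i
    using moment[of i] that by (simp add: J_def)
  with b(1) show False
    by blast
qed

section \<open>Spectral decomposition of symmetric matrices\<close>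

interpretation cnj_hom: comm_ring_hom cnj
  by standard auto

lemma mat_adjoint_conv_transpose: "mat_adjoint (A :: complex mat) = transpose_mat (map_mat cnj A)"
  by (rule eq_matI) (auto simp: mat_adjoint_def mat_of_rows_index)

lemma mat_adjoint_carrier [simp]:
  "(A :: complex mat) \<in> carrier_mat n m \<Longrightarrow> mat_adjoint A \<in> carrier_mat m n"
  by (auto simp: mat_adjoint_conv_transpose)

lemma mat_adjoint_mult:
  fixes A B :: "complex mat"
  assumes "A \<in> carrier_mat n m" "B \<in> carrier_mat m l"
  shows "mat_adjoint (A * B) = mat_adjoint B * mat_adjoint A"
  unfolding mat_adjoint_conv_transpose cnj_hom.mat_hom_mult[OF assms]
  by (rule transpose_mult) (use assms in auto)

lemma mat_adjoint_adjoint [simp]: "mat_adjoint (mat_adjoint (A :: complex mat)) = A"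
  by (rule eq_matI) (auto simp: mat_adjoint_conv_transpose)

lemma mat_adjoint_index [simp]:
  "i < dim_col A \<Longrightarrow> j < dim_row A \<Longrightarrow> mat_adjoint A $$ (i, j) = cnj (A $$ (j, i))"
  by (auto simp: mat_adjoint_conv_transpose)

text \<open>The first step of a unitary triangularization: complete an eigenvector to a basis and
  orthogonalize. Gram-Schmidt leaves the vectors unnormalized, and normalizing them is what makes the
  inverse of \<open>W\<close> its adjoint, so that conjugation by \<open>W\<close> preserves Hermitian matrices.\<close>

lemma ex_unitary_hd_eigenvector:
  fixes A :: "complex mat"
  assumes A: "A \<in> carrier_mat n n" and e: "eigenvalue A e" and n: "n \<noteq> 0"
  shows "\<exists>W \<in> carrier_mat n n. mat_adjoint W * W = 1\<^sub>m n \<and>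
    col (mat_adjoint W * A * W) 0 = vec n (\<lambda>i. if i = 0 then e else 0)"
proof -
  define v where "v = find_eigenvector A e"
  have "eigenvector A v e"
    unfolding v_def by (rule find_eigenvector[OF A e])
  then have v: "v \<in> carrier_vec n" "v \<noteq> 0\<^sub>v n" and Av: "A *\<^sub>v v = e \<cdot>\<^sub>v v"
    using A unfolding eigenvector_def by auto
  define b where "b = basis_completion v"
  interpret cof_vec_space n "TYPE(complex)" .
  from basis_completion[OF v, folded b_def]
  have dist_b: "distinct b" and indep: "\<not> lin_dep (set b)" and b: "set b \<subseteq> carrier_vec n"
    and hdb: "hd b = v" and len_b: "length b = n"
    by auto
  from hdb len_b n obtain bs where bv: "b = v # bs"
    by (cases b) auto
  define ws where "ws = gram_schmidt n b"
  from gram_schmidt_result[OF b dist_b indep refl, folded ws_def]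
  have ws: "set ws \<subseteq> carrier_vec n" "corthogonal ws" "length ws = n"
    by (auto simp: len_b)
  have hdws: "hd ws = v"
    using gram_schmidt_hd[OF v(1), of bs, folded bv] by (simp add: ws_def)
  \<comment> \<open>The normalizing factor of a vector.\<close>
  define r where "r w = complex_of_real (1 / sqrt (Re (w \<bullet>c w)))" for w :: "complex vec"
  define us where "us = map (\<lambda>w. r w \<cdot>\<^sub>v w) ws"
  have wsc: "ws ! i \<in> carrier_vec n" if "i < n" for i
    using ws that by auto
  have prod: "us ! i \<bullet>c us ! j = r (ws ! i) * r (ws ! j) * (ws ! i \<bullet>c ws ! j)"
    if "i < n" "j < n" for i j
    using wsc[OF that(1)] wsc[OF that(2)] that ws(3)
    by (simp add: us_def conjugate_smult_vec r_def)
  have norm: "us ! i \<bullet>c us ! i = 1" if i: "i < n" for i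
  proof -
    have ne: "ws ! i \<bullet>c ws ! i \<noteq> 0"
      using corthogonalD[OF ws(2)] i ws(3) by auto
    have "ws ! i \<bullet>c ws ! i \<ge> 0"
      by (rule conjugate_square_ge_0_vec)
    then have eq: "ws ! i \<bullet>c ws ! i = complex_of_real (Re (ws ! i \<bullet>c ws ! i))"
        and "Re (ws ! i \<bullet>c ws ! i) \<ge> 0"
      by (auto simp: less_eq_complex_def complex_eq_iff)
    with ne have pos: "Re (ws ! i \<bullet>c ws ! i) > 0"
      by (metis less_eq_real_def of_real_0)
    show ?thesis
      unfolding prod[OF i i] r_def
      by (subst (3) eq) (use pos in \<open>simp add: of_real_mult[symmetric] del: of_real_mult\<close>)
  qed
  have us: "set us \<subseteq> carrier_vec n" "length us = n"
    using ws by (auto simp: us_def)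
  have ortho: "us ! i \<bullet>c us ! j = 0" if "i < n" "j < n" "i \<noteq> j" for i j
    using corthogonalD[OF ws(2)] that ws(3) by (auto simp: prod)
  have co: "corthogonal us"
    by (rule corthogonalI) (use us norm ortho in force)
  define W where "W = mat_of_cols n us"
  have W: "W \<in> carrier_mat n n"
    using us by (auto simp: W_def)
  have adj: "corthogonal_inv W = mat_adjoint W"
  proof (rule eq_matI)
    show "dim_row (corthogonal_inv W) = dim_row (mat_adjoint W)"
      "dim_col (corthogonal_inv W) = dim_col (mat_adjoint W)"
      using W by (auto simp: corthogonal_inv_def mat_adjoint_conv_transpose)
    fix i j assume "i < dim_row (mat_adjoint W)" "j < dim_col (mat_adjoint W)"
    then have ij: "i < n" "j < n"
      using W by (auto simp: mat_adjoint_conv_transpose)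
    have usi: "us ! i \<in> carrier_vec n"
      using us ij by auto
    have "corthogonal_inv W $$ (i, j) = vec_inv (us ! i) $ j"
      unfolding corthogonal_inv_def using W ij us
      by (simp add: mat_of_rows_index W_def)
    also have "\<dots> = cnj (W $$ (j, i))"
      using norm[OF ij(1)] usi ij us by (simp add: vec_inv_def W_def mat_of_cols_index)
    finally show "corthogonal_inv W $$ (i, j) = mat_adjoint W $$ (i, j)"
      using W ij by simp
  qed
  have "ws ! 0 = v"
    using hdws ws(3) n by (cases ws) auto
  then have "us ! 0 = r v \<cdot>\<^sub>v v"
    using ws(3) n by (simp add: us_def)
  moreover have "us \<noteq> []"
    using us n by auto
  ultimately have hdus: "hd us = r v \<cdot>\<^sub>v v"
    by (simp add: hd_conv_nth)
  define v' where "v' = hd us"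
  have v': "v' \<in> carrier_vec n"
    using v by (simp add: v'_def hdus)
  have "v' \<bullet>c v' = 1"
    using norm[of 0] n \<open>us \<noteq> []\<close> by (simp add: v'_def hd_conv_nth)
  then have v'0: "v' \<noteq> 0\<^sub>v n"
    by auto
  have Av': "A *\<^sub>v v' = e \<cdot>\<^sub>v v'"
    unfolding v'_def hdus using mult_mat_vec[OF A v(1), of "r v"] Av
    by (simp add: smult_smult_assoc mult.commute)
  have "inverts_mat (corthogonal_inv W) W"
    by (rule corthogonal_inv_result) (unfold W_def, rule orthogonal_mat_of_cols[OF us(1) co us(2)])
  then have "mat_adjoint W * W = 1\<^sub>m n"
    using W by (simp add: adj inverts_mat_def mat_adjoint_conv_transpose)
  moreover have "col (mat_adjoint W * A * W) 0 = vec n (\<lambda>i. if i = 0 then e else 0)"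
    using corthogonal_col_ev_0[OF A v' v'0 Av' n v'_def[symmetric] us(1) co us(2)]
    unfolding W_def[symmetric] adj .
  ultimately show ?thesis
    using W by blast
qed

text \<open>After conjugation with a unitary matrix whose first column is an eigenvector, the first column
  is zero below the diagonal; being still Hermitian, the matrix then has zero entries in the first row
  as well and splits into a block of size one and a smaller Hermitian matrix.\<close>

lemma hermitian_unitarily_diagonalizable:
  fixes A :: "complex mat"
  assumes "A \<in> carrier_mat n n" "mat_adjoint A = A"
  shows "\<exists>D P. similar_mat_wit A D P (mat_adjoint P) \<and> diagonal_mat D"
  using assms
proof (induction n arbitrary: A)
  case 0
  have "similar_mat_wit A A (1\<^sub>m 0) (mat_adjoint (1\<^sub>m 0))"
    by (rule similar_mat_witI[of _ _ 0]) (use 0 in \<open>auto simp: mat_adjoint_conv_transpose\<close>)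
  with 0 show ?case
    by (auto simp: diagonal_mat_def)
next
  case (Suc n)
  note A = Suc.prems(1) and herm = Suc.prems(2)
  obtain e where e: "eigenvalue A e"
    using spectrum_non_empty[OF A] by (auto simp: spectrum_def)
  obtain W where W: "W \<in> carrier_mat (Suc n) (Suc n)" and WW: "mat_adjoint W * W = 1\<^sub>m (Suc n)"
    and col0: "col (mat_adjoint W * A * W) 0 = vec (Suc n) (\<lambda>i. if i = 0 then e else 0)"
    using ex_unitary_hd_eigenvector[OF A e] by auto
  note aW = mat_adjoint_carrier[OF W]
  have WW': "W * mat_adjoint W = 1\<^sub>m (Suc n)"
    by (rule mat_mult_left_right_inverse[OF aW W WW])
  define A' where "A' = mat_adjoint W * A * W"
  have A': "A' \<in> carrier_mat (Suc n) (Suc n)"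
    using A W aW by (auto simp: A'_def intro!: mult_carrier_mat)
  have herm': "mat_adjoint A' = A'"
    using A W aW herm
    by (simp add: A'_def mat_adjoint_mult[of _ "Suc n" "Suc n" _ "Suc n"] assoc_mult_mat[of _ "Suc n" "Suc n" _ "Suc n" _ "Suc n"])
  have simA: "similar_mat_wit A A' W (mat_adjoint W)"
  proof (rule similar_mat_wit_sym, rule similar_mat_witI[of _ _ "Suc n"])
    show "A' = mat_adjoint W * A * W"
      by (rule A'_def)
  qed (use A W aW A' WW WW' in auto)
  have zero_col: "A' $$ (Suc i, 0) = 0" if "i < n" for i
    using arg_cong[OF col0, of "\<lambda>v. v $ Suc i"] that A' by (simp flip: A'_def)
  have zero_row: "A' $$ (0, Suc i) = 0" if "i < n" for i
    using arg_cong[OF herm', of "\<lambda>M. M $$ (0, Suc i)"] that A' zero_col by simp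
  define B where "B = mat n n (\<lambda>(i, j). A' $$ (Suc i, Suc j))"
  define E where "E = mat 1 1 (\<lambda>_. A' $$ (0, 0))"
  have block: "A' = four_block_mat E (0\<^sub>m 1 n) (0\<^sub>m n 1) B"
  proof (rule eq_matI)
    fix i j
    assume "i < dim_row (four_block_mat E (0\<^sub>m 1 n) (0\<^sub>m n 1) B)"
      "j < dim_col (four_block_mat E (0\<^sub>m 1 n) (0\<^sub>m n 1) B)"
    then show "A' $$ (i, j) = four_block_mat E (0\<^sub>m 1 n) (0\<^sub>m n 1) B $$ (i, j)"
      using zero_col zero_row by (cases i; cases j) (auto simp: B_def E_def)
  qed (use A' in \<open>auto simp: B_def E_def\<close>)
  have B: "B \<in> carrier_mat n n" and E: "E \<in> carrier_mat 1 1"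
    by (auto simp: B_def E_def)
  have "mat_adjoint B = B"
  proof (rule eq_matI)
    fix i j assume "i < dim_row B" "j < dim_col B"
    then show "mat_adjoint B $$ (i, j) = B $$ (i, j)"
      using arg_cong[OF herm', of "\<lambda>M. M $$ (Suc i, Suc j)"] A' by (simp add: B_def)
  qed (use B in \<open>auto simp: mat_adjoint_conv_transpose\<close>)
  from Suc.IH[OF B this] obtain D P where simB: "similar_mat_wit B D P (mat_adjoint P)"
    and diag: "diagonal_mat D"
    by blast
  note wit = similar_mat_witD2[OF B simB]
  have D: "D \<in> carrier_mat n n" and P: "P \<in> carrier_mat n n" 
    using wit by auto
  define P1 where "P1 = four_block_mat (1\<^sub>m 1) (0\<^sub>m 1 n) (0\<^sub>m n 1) P"
  define D1 where "D1 = four_block_mat E (0\<^sub>m 1 n) (0\<^sub>m n 1) D"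
  have P1: "P1 \<in> carrier_mat (Suc n) (Suc n)"
    using P by (auto simp: P1_def)
  have adjP1: "mat_adjoint P1 = four_block_mat (1\<^sub>m 1) (0\<^sub>m 1 n) (0\<^sub>m n 1) (mat_adjoint P)"
    by (rule eq_matI) (use P in \<open>auto simp: P1_def mat_adjoint_conv_transpose\<close>)
  have zero_adjP: "0\<^sub>m 1 n * mat_adjoint P = 0\<^sub>m 1 n"
    by (rule left_mult_zero_mat[OF mat_adjoint_carrier[OF P]])
  have "similar_mat_wit A' D1 P1 (mat_adjoint P1)"
    unfolding block D1_def adjP1 unfolding P1_def
    by (rule similar_mat_wit_four_block[OF similar_mat_wit_refl[OF E] simB _ _ E B])
      (use P zero_adjP in auto)
  from similar_mat_wit_trans[OF simA this]
  have "similar_mat_wit A D1 (W * P1) (mat_adjoint (W * P1))"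
    by (simp add: mat_adjoint_mult[OF W P1])
  moreover have "diagonal_mat D1"
    using diag D E by (auto simp: diagonal_mat_def D1_def)
  ultimately show ?case
    by blast
qed

lemma index_mult_mat_sum:
  assumes "A \<in> carrier_mat l n" "B \<in> carrier_mat n m" "i < l" "j < m"
  shows "(A * B) $$ (i, j) = (\<Sum>k<n. A $$ (i, k) * B $$ (k, j))"
  using assms by (simp add: scalar_prod_def atLeast0LessThan)

text \<open>The spectral theorem in the coordinates in which it is used: \<open>\<lambda>v. p v i\<close> is the \<open>i\<close>-th eigenvector,
  with eigenvalue \<open>d i\<close>. Complex eigenvectors suffice, since they are paired with complex vectors
  anyway.\<close>

lemma symmetric_real_spectral_decomposition:
  fixes A :: "real mat"
  assumes A: "A \<in> carrier_mat n n" and sym: "transpose_mat A = A"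
  obtains d :: "nat \<Rightarrow> real" and p :: "nat \<Rightarrow> nat \<Rightarrow> complex" where
    "char_poly A = (\<Prod>i<n. [:- d i, 1:])"
    "\<And>i j. i < n \<Longrightarrow> j < n \<Longrightarrow> (\<Sum>v<n. cnj (p v i) * p v j) = (if i = j then 1 else 0)"
    "\<And>v w. v < n \<Longrightarrow> w < n \<Longrightarrow>
      complex_of_real (A $$ (v, w)) = (\<Sum>i<n. complex_of_real (d i) * p v i * cnj (p w i))"
proof -
  interpret map_poly_of_real: map_poly_inj_comm_ring_hom complex_of_real ..
  define C where "C = map_mat complex_of_real A"
  have C: "C \<in> carrier_mat n n"
    using A by (simp add: C_def)
  have herm: "mat_adjoint C = C"
  proof (rule eq_matI)
    fix i j assume "i < dim_row C" "j < dim_col C"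
    then show "mat_adjoint C $$ (i, j) = C $$ (i, j)"
      using arg_cong[OF sym, of "\<lambda>M. M $$ (i, j)"] A by (simp add: C_def)
  qed (use C in \<open>auto simp: mat_adjoint_conv_transpose\<close>)
  obtain D P where sim: "similar_mat_wit C D P (mat_adjoint P)" and diag: "diagonal_mat D"
    using hermitian_unitarily_diagonalizable[OF C herm] by blast
  note wit = similar_mat_witD2[OF C sim]
  have D: "D \<in> carrier_mat n n" and P: "P \<in> carrier_mat n n"
    and inv: "mat_adjoint P * P = 1\<^sub>m n" and CPD: "C = P * D * mat_adjoint P"
    using wit by blast+
  note aP = mat_adjoint_carrier[OF P]
  have "D = mat_adjoint P * C * P"
    using similar_mat_witD2(3)[OF D similar_mat_wit_sym[OF sim]] .
  then have hermD: "mat_adjoint D = D"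
    using C P aP herm
    by (simp add: mat_adjoint_mult[of _ n n _ n] assoc_mult_mat[of _ n n _ n _ n])
  define d where "d i = Re (D $$ (i, i))" for i
  define p where "p v i = P $$ (v, i)" for v i
  have D_entry: "D $$ (i, j) = (if i = j then complex_of_real (d i) else 0)"
    if ij: "i < n" "j < n" for i j
  proof (cases "i = j")
    case True
    have "cnj (D $$ (i, i)) = D $$ (i, i)"
      using arg_cong[OF hermD, of "\<lambda>M. M $$ (i, i)"] D ij by simp
    with True show ?thesis
      by (simp add: d_def complex_eq_iff)
  next
    case False
    with diag D ij show ?thesis
      by (auto simp: diagonal_mat_def)
  qed
  have "char_poly C = char_poly D"
    by (rule char_poly_similar) (use sim in \<open>auto simp: similar_mat_def\<close>)
  also have "\<dots> = (\<Prod>a\<leftarrow>diag_mat D. [:- a, 1:])"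
    by (rule char_poly_upper_triangular[OF D]) (use D D_entry in auto)
  also have "\<dots> = (\<Prod>i<n. [:- D $$ (i, i), 1:])"
    using D by (simp add: diag_mat_def o_def prod.list_conv_set_nth atLeast0LessThan)
  also have "\<dots> = (\<Prod>i<n. map_poly complex_of_real [:- d i, 1:])"
    by (rule prod.cong) (auto simp: D_entry)
  also have "\<dots> = map_poly complex_of_real (\<Prod>i<n. [:- d i, 1:])"
    by (simp only: map_poly_of_real.hom_prod)
  finally have "char_poly A = (\<Prod>i<n. [:- d i, 1:])"
    unfolding C_def of_real_hom.char_poly_hom[OF A] by (rule map_poly_of_real.injectivity)
  moreover have "(\<Sum>v<n. cnj (p v i) * p v j) = (if i = j then 1 else 0)"
    if "i < n" "j < n" for i j
    using arg_cong[OF inv, of "\<lambda>M. M $$ (i, j)"] that P aP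
    by (simp add: scalar_prod_def p_def atLeast0LessThan)
  moreover have "complex_of_real (A $$ (v, w)) =
      (\<Sum>i<n. complex_of_real (d i) * p v i * cnj (p w i))" if vw: "v < n" "w < n" for v w
  proof -
    have PD: "(P * D) $$ (v, i) = complex_of_real (d i) * p v i" if i: "i < n" for i
    proof -
      have "(P * D) $$ (v, i) = (\<Sum>j<n. P $$ (v, j) * D $$ (j, i))"
        by (rule index_mult_mat_sum[OF P D vw(1) i])
      also have "\<dots> = (\<Sum>j<n. if j = i then complex_of_real (d j) * p v j else 0)"
        by (rule sum.cong) (use i in \<open>auto simp: D_entry p_def\<close>)
      finally show ?thesis
        using i by simp
    qed
    have "complex_of_real (A $$ (v, w)) = (P * D * mat_adjoint P) $$ (v, w)"
      using A vw by (simp add: C_def flip: CPD)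
    also have "\<dots> = (\<Sum>i<n. (P * D) $$ (v, i) * mat_adjoint P $$ (i, w))"
      by (rule index_mult_mat_sum[OF mult_carrier_mat[OF P D] aP vw])
    also have "\<dots> = (\<Sum>i<n. complex_of_real (d i) * p v i * cnj (p w i))"
      by (rule sum.cong) (use P vw PD in \<open>auto simp: p_def\<close>)
    finally show ?thesis .
  qed
  ultimately show thesis
    by (rule that)
qed

section \<open>Counting eigenvalues\<close>

lemma order_prod_linear_factors:
  fixes d :: "'i \<Rightarrow> 'f::field"
  assumes "finite I"
  shows "Polynomial.order k (\<Prod>i\<in>I. [:- d i, 1:]) = card {i\<in>I. d i = k}"
  using assms
proof (induction I rule: finite_induct)
  case (insert j I)
  have "{i \<in> insert j I. d i = k} = (if d j = k then insert j {i\<in>I. d i = k} else {i\<in>I. d i = k})"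
    by auto
  moreover have "Polynomial.order k [:- d j, 1:] = (if d j = k then 1 else 0)"
    using order_linear_power[of k "- d j" 1] by auto
  moreover have "[:- d j, 1:] * (\<Prod>i\<in>I. [:- d i, 1:]) \<noteq> 0"
    using insert.hyps by (simp del: mult_pCons_left)
  ultimately show ?case
    using insert by (simp add: order_mult del: mult_pCons_left)
qed simp

text \<open>Multiplicities are root orders of the characteristic polynomial, hence sizes of the fibres of
  the enumeration \<open>d\<close> of its roots.\<close>

lemma count_eigenvalues_eq_card:
  assumes A: "A \<in> carrier_mat n n" and cp: "char_poly A = (\<Prod>i<n. [:- d i, 1:])"
  shows "count_eigenvalues A S = card {i\<in>{..<n}. d i \<in> S}"
proof -
  have ev: "eigenvalue A k \<longleftrightarrow> k \<in> d ` {..<n}" for k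
    unfolding eigenvalue_root_char_poly[OF A] cp by (auto simp: poly_prod)
  have "count_eigenvalues A S = (\<Sum>k\<in>d ` {i\<in>{..<n}. d i \<in> S}. card {i\<in>{..<n}. d i = k})"
    unfolding count_eigenvalues_def cp order_prod_linear_factors[OF finite_lessThan]
    by (rule sum.cong) (auto simp: ev)
  also have "\<dots> = card (\<Union>k\<in>d ` {i\<in>{..<n}. d i \<in> S}. {i\<in>{..<n}. d i = k})"
    by (rule card_UN_disjoint[symmetric]) auto
  also have "(\<Union>k\<in>d ` {i\<in>{..<n}. d i \<in> S}. {i\<in>{..<n}. d i = k}) = {i\<in>{..<n}. d i \<in> S}"
    by auto
  finally show ?thesis .
qed

section \<open>The inertia bound for the orthogonal rank\<close>

theorem theorem1:
  fixes G :: "('a, 'b) pre_digraph" and vs :: "'a list"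
    and n_pos n_zero n_neg :: nat
  assumes "graph G"
    and "distinct vs" and "set vs = verts G"
    and "inertia (adjacency_matrix G vs) = (n_pos, n_zero, n_neg)"
  shows "1 + max (real n_pos / real n_neg) (real n_neg / real n_pos) \<le> real (orthogonal_rank G)"
proof -
  interpret graph G by (rule assms(1))
  define n where "n = length vs"
  define A where "A = adjacency_matrix G vs"
  define m where "m = orthogonal_rank G"
  obtain x where x: "orthogonal_representation G m x"
    unfolding m_def using orthogonal_rank_attained(2)[OF assms(1)] by blast
  have m: "0 < m"
    unfolding m_def by (rule orthogonal_rank_attained(1)[OF assms(1)])
  have A: "A \<in> carrier_mat n n"
    by (simp add: A_def adjacency_matrix_def n_def)
  have A_entry: "A $$ (i, j) = (if vs ! i \<rightarrow>\<^bsub>G\<^esub> vs ! j then 1 else 0)" if "i < n" "j < n" for i j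
    using that by (simp add: A_def adjacency_matrix_def n_def)
  have A_sym: "transpose_mat A = A"
    by (rule eq_matI) (use A A_entry arcs_ends_symmetric[OF sym_arcs] in auto)
  obtain d p where cp: "char_poly A = (\<Prod>i<n. [:- d i, 1:])"
    and orth: "\<And>i j. i < n \<Longrightarrow> j < n \<Longrightarrow> (\<Sum>v<n. cnj (p v i) * p v j) = (if i = j then 1 else 0)"
    and spec: "\<And>v w. v < n \<Longrightarrow> w < n \<Longrightarrow>
      complex_of_real (A $$ (v, w)) = (\<Sum>i<n. complex_of_real (d i) * p v i * cnj (p w i))"
    by (rule symmetric_real_spectral_decomposition[OF A A_sym]) (rule that; simp)
  have counts: "n_pos = card {i\<in>{..<n}. 0 < d i}" "n_neg = card {i\<in>{..<n}. d i < 0}"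
    using assms(4) unfolding inertia_def A_def[symmetric] count_eigenvalues_eq_card[OF A cp] by auto
  define y where "y i k = x (vs ! i) $ k" for i k
  have vert: "vs ! i \<in> verts G" if "i < n" for i
    using nth_mem[of i vs] that unfolding assms(3) n_def by blast
  have dim: "dim_vec (x (vs ! i)) = m" if "i < n" for i
    using x vert[OF that] by (auto simp: orthogonal_representation_def)
  have nonzero: "\<exists>k<m. y i k \<noteq> 0" if i: "i < n" for i
  proof (rule ccontr)
    assume "\<not> ?thesis"
    then have "x (vs ! i) = 0\<^sub>v m"
      using dim[OF i] by (auto simp: y_def)
    with x vert[OF i] show False
      by (auto simp: orthogonal_representation_def)
  qed
  have isotropic: "complex_of_real (A $$ (i, j)) * (\<Sum>k<m. cnj (y i k) * y j k) = 0"
    if ij: "i < n" "j < n" for i j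
  proof (cases "vs ! i \<rightarrow>\<^bsub>G\<^esub> vs ! j")
    case True
    then have "conjugate (x (vs ! i)) \<bullet> x (vs ! j) = 0"
      using x by (auto simp: orthogonal_representation_def)
    then show ?thesis
      using dim ij by (simp add: scalar_prod_def y_def atLeast0LessThan)
  qed (simp add: A_entry ij)
  have pos_le: "n_pos \<le> (m - 1) * n_neg"
    unfolding counts
    by (rule card_positive_le_card_negative[where V = "{..<n}" and p = p and x = y])
      (use m orth nonzero isotropic in \<open>auto simp flip: spec\<close>)
  \<comment> \<open>The same bound for the negated matrix, which has the same eigenvectors.\<close>
  have neg_le: "n_neg \<le> (m - 1) * n_pos"
    using card_positive_le_card_negative[where V = "{..<n}" and I = "{..<n}" and p = p and x = y
        and d = "\<lambda>i. - d i" and m = m] m orth nonzero isotropic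
    unfolding counts by (auto simp: sum_negf simp flip: spec)
  \<comment> \<open>If \<open>b = 0\<close>, the quotient is \<open>0\<close> by convention and the claim is \<open>1 \<le> m\<close>.\<close>
  have ratio: "real a / real b \<le> real m - 1" if "a \<le> (m - 1) * b" for a b :: nat
  proof (cases "b = 0")
    case False
    have "real a \<le> real ((m - 1) * b)"
      using that by (rule of_nat_mono)
    with False m show ?thesis
      by (simp add: divide_le_eq of_nat_diff)
  qed (use m in simp)
  show ?thesis
    using ratio[OF pos_le] ratio[OF neg_le] by (simp flip: m_def)
qed

end
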